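(* Let $n\ge 1$ be an integer, let $\alpha,b>0$, $\delta\in(0,1)$, $0<a_0\le a_1$ be real numbers, and let $\tau_0,\tau_1,\tau_2\ge 0$ be integers. Consider the delayed discrete-time system $$\begin{cases} q_0(t+1)=q_0(t)+\alpha q_0(t)\Big[a_0-bq_0(t)-b\delta\sum_{i=1}^n q_i(t-\tau_1)\Big],\\[2pt] q_j(t+1)=\dfrac{a_1}{2b}-\dfrac{\delta}{2}q_0(t-\tau_0)-\dfrac{\delta}{2}\sum_{i=1,\,i\ne j}^n q_i(t-\tau_2),\quad j=1,\dots,n,\end{cases}$$ and its equilibrium point $E_0=(0,q^\star,\dots,q^\star)\in\mathbb{R}^{n+1}$, where $q^\star=\dfrac{a_1}{b[2+(n-1)\delta]}$. If $$[2+(n-1)\delta]\,a_0>n\delta a_1,$$ then $E_0$ is a saddle point of the system.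
   Context: Let $\tau=\max\{\tau_0,\tau_1,\tau_2\}$. The delayed system is identified with the (delay-free) map $F$ on $\mathbb{R}^{(n+1)(\tau+1)}$ that sends the history $(q(t),q(t-1),\dots,q(t-\tau))$, with $q=(q_0,\dots,q_n)$, to $(q(t+1),q(t),\dots,q(t-\tau+1))$. An equilibrium $E\in\mathbb{R}^{n+1}$ corresponds to the fixed point $(E,\dots,E)$ of $F$. The equilibrium $E$ is called a saddle point if the Jacobian matrix of $F$ at $(E,\dots,E)$ has at least one eigenvalue of modulus strictly greater than $1$ and at least one eigenvalue of modulus strictly less than $1$ (no hyperbolicity is required). The nonzero eigenvalues are the nonzero roots of the characteristic equation obtained by substituting $y(t)=\lambda^t v$ into the linearization of the system at $E$. *)

theory Defs
  imports Complex_Main "Jordan_Normal_Form.Char_Poly"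
begin

text \<open>
  A delayed system in \<open>d\<close> variables is given by its right-hand side
  \<open>G :: (nat \<Rightarrow> nat \<Rightarrow> real) \<Rightarrow> nat \<Rightarrow> real\<close>: if \<open>h i k\<close> is the delayed value \<open>q\<^sub>i(t - k)\<close>, then
  \<open>G h j\<close> is \<open>q\<^sub>j(t + 1)\<close>, for \<open>i, j < d\<close>.
  The history \<open>(q(t), q(t - 1), \<dots>, q(t - \<tau>))\<close> is stored as one vector of dimension
  \<open>d * (\<tau> + 1)\<close>, with \<open>q\<^sub>i(t - k)\<close> at position \<open>k * d + i\<close>.
\<close>

definition delay_map ::
  "nat \<Rightarrow> nat \<Rightarrow> ((nat \<Rightarrow> nat \<Rightarrow> real) \<Rightarrow> nat \<Rightarrow> real) \<Rightarrow> real vec \<Rightarrow> real vec" where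
  "delay_map d \<tau> G x =
     vec (d * (\<tau> + 1)) (\<lambda>m. if m < d then G (\<lambda>i k. x $ (k * d + i)) m else x $ (m - d))"

definition const_history :: "nat \<Rightarrow> nat \<Rightarrow> real vec \<Rightarrow> real vec" where
  "const_history d \<tau> E = vec (d * (\<tau> + 1)) (\<lambda>m. E $ (m mod d))"

definition is_equilibrium ::
  "nat \<Rightarrow> nat \<Rightarrow> ((nat \<Rightarrow> nat \<Rightarrow> real) \<Rightarrow> nat \<Rightarrow> real) \<Rightarrow> real vec \<Rightarrow> bool" where
  "is_equilibrium d \<tau> G E \<longleftrightarrow>
     E \<in> carrier_vec d \<and> delay_map d \<tau> G (const_history d \<tau> E) = const_history d \<tau> E"

text \<open>
  The Jacobian matrix is introduced as a relation, so that existence of the partial derivatives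
  is part of it; it is unique whenever it exists.
\<close>

definition is_jacobian :: "nat \<Rightarrow> (real vec \<Rightarrow> real vec) \<Rightarrow> real vec \<Rightarrow> real mat \<Rightarrow> bool" where
  "is_jacobian N F x J \<longleftrightarrow>
     J \<in> carrier_mat N N \<and>
     (\<forall>i<N. \<forall>j<N.
        ((\<lambda>s. F (vec N (\<lambda>l. if l = j then s else x $ l)) $ i)
           has_real_derivative J $$ (i, j)) (at (x $ j)))"

definition saddle_point ::
  "nat \<Rightarrow> nat \<Rightarrow> ((nat \<Rightarrow> nat \<Rightarrow> real) \<Rightarrow> nat \<Rightarrow> real) \<Rightarrow> real vec \<Rightarrow> bool" where
  "saddle_point d \<tau> G E \<longleftrightarrow>
     is_equilibrium d \<tau> G E \<and>
     (\<exists>J. is_jacobian (d * (\<tau> + 1)) (delay_map d \<tau> G) (const_history d \<tau> E) J \<and>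
          (\<exists>z. eigenvalue (map_mat complex_of_real J) z \<and> cmod z > 1) \<and>
          (\<exists>z. eigenvalue (map_mat complex_of_real J) z \<and> cmod z < 1))"

definition oligopoly_rhs ::
  "nat \<Rightarrow> real \<Rightarrow> real \<Rightarrow> real \<Rightarrow> real \<Rightarrow> real \<Rightarrow> nat \<Rightarrow> nat \<Rightarrow> nat
     \<Rightarrow> (nat \<Rightarrow> nat \<Rightarrow> real) \<Rightarrow> nat \<Rightarrow> real" where
  "oligopoly_rhs n \<alpha> b \<delta> a0 a1 \<tau>0 \<tau>1 \<tau>2 q j =
     (if j = 0
      then q 0 0 + \<alpha> * q 0 0 * (a0 - b * q 0 0 - b * \<delta> * (\<Sum>i\<in>{1..n}. q i \<tau>1))
      else a1 / (2 * b) - \<delta> / 2 * q 0 \<tau>0 - \<delta> / 2 * (\<Sum>i\<in>{1..n} - {j}. q i \<tau>2))"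

definition boundary_equilibrium :: "nat \<Rightarrow> real \<Rightarrow> real \<Rightarrow> real \<Rightarrow> real vec" where
  "boundary_equilibrium n b \<delta> a1 =
     vec (n + 1) (\<lambda>j. if j = 0 then 0 else a1 / (b * (2 + (real n - 1) * \<delta>)))"

text \<open>The map on histories advances every solution of the delayed system by one time step.\<close>

definition history :: "nat \<Rightarrow> nat \<Rightarrow> (int \<Rightarrow> nat \<Rightarrow> real) \<Rightarrow> int \<Rightarrow> real vec" where
  "history d \<tau> q t = vec (d * (\<tau> + 1)) (\<lambda>m. q (t - int (m div d)) (m mod d))"

lemma history_nth:
  assumes "i < d" "k \<le> \<tau>"
  shows "history d \<tau> q t $ (k * d + i) = q (t - int k) i"
proof -
  have "k * d + i < (k + 1) * d" using assms(1) by simp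
  also have "\<dots> \<le> (\<tau> + 1) * d" using assms(2) by (intro mult_right_mono) auto
  finally have "k * d + i < d * (\<tau> + 1)" by (simp add: mult.commute)
  then show ?thesis using assms(1) by (simp add: history_def)
qed

lemma delay_map_history:
  fixes q :: "int \<Rightarrow> nat \<Rightarrow> real"
  assumes "\<tau>0 \<le> \<tau>" "\<tau>1 \<le> \<tau>" "\<tau>2 \<le> \<tau>"
    and sol: "\<And>j. j \<le> n \<Longrightarrow>
      q (t + 1) j = oligopoly_rhs n \<alpha> b \<delta> a0 a1 \<tau>0 \<tau>1 \<tau>2 (\<lambda>i k. q (t - int k) i) j"
  shows "delay_map (n + 1) \<tau> (oligopoly_rhs n \<alpha> b \<delta> a0 a1 \<tau>0 \<tau>1 \<tau>2) (history (n + 1) \<tau> q t)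
    = history (n + 1) \<tau> q (t + 1)"
    (is "?L = ?R")
proof (rule eq_vecI)
  show "dim_vec ?L = dim_vec ?R" by (simp add: delay_map_def history_def)
next
  fix m assume "m < dim_vec ?R"
  then have m: "m < (n + 1) * (\<tau> + 1)" by (simp add: history_def)
  let ?h = "\<lambda>i k. history (n + 1) \<tau> q t $ (k * (n + 1) + i)"
  show "?L $ m = ?R $ m"
  proof (cases "m < n + 1")
    case True
    have h: "?h i k = q (t - int k) i" if "i \<le> n" "k \<le> \<tau>" for i k
      using history_nth[of i "n + 1" k \<tau> q t] that by simp
    have s1: "(\<Sum>i\<in>{1..n}. ?h i \<tau>1) = (\<Sum>i\<in>{1..n}. q (t - int \<tau>1) i)"
      by (rule sum.cong[OF refl], rule h) (use assms in auto)
    have s2: "(\<Sum>i\<in>{1..n} - {m}. ?h i \<tau>2) = (\<Sum>i\<in>{1..n} - {m}. q (t - int \<tau>2) i)"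
      by (rule sum.cong[OF refl], rule h) (use assms in auto)
    have "?L $ m = oligopoly_rhs n \<alpha> b \<delta> a0 a1 \<tau>0 \<tau>1 \<tau>2 ?h m"
      using True m unfolding delay_map_def by (subst index_vec) simp_all
    also have "\<dots> = oligopoly_rhs n \<alpha> b \<delta> a0 a1 \<tau>0 \<tau>1 \<tau>2 (\<lambda>i k. q (t - int k) i) m"
      unfolding oligopoly_rhs_def s1 s2 h[of 0 0, OF le0 le0] h[of 0 \<tau>0, OF le0 assms(1)] ..
    also have "\<dots> = q (t + 1) m" using sol[of m] True by simp
    also have "\<dots> = ?R $ m" using True m by (simp add: history_def)
    finally show ?thesis .
  next
    case False
    have "?L $ m = history (n + 1) \<tau> q t $ (m - (n + 1))"
      using False m unfolding delay_map_def by (subst index_vec) simp_all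
    also have "\<dots> = q (t - int ((m - (n + 1)) div (n + 1))) ((m - (n + 1)) mod (n + 1))"
      using m unfolding history_def by (subst index_vec) simp_all
    also have "\<dots> = q (t + 1 - int (m div (n + 1))) (m mod (n + 1))"
      using False by (simp add: le_div_geq le_mod_geq not_less)
    also have "\<dots> = ?R $ m" using m unfolding history_def by (subst index_vec) simp_all
    finally show ?thesis .
  qed
qed

end

theory Submission
  imports Defs
begin

text \<open>
  Since \<open>q\<^sub>0 = 0\<close> at the equilibrium, the first row of the Jacobian matrix is the multiple
  \<open>1 + \<alpha> (a\<^sub>0 - b \<delta> n q\<^sup>\<star>)\<close> of the first unit vector, so this number, which exceeds \<open>1\<close> by
  hypothesis, is an eigenvalue (with a left eigenvector). For \<open>n \<ge> 2\<close> the antisymmetric perturbations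
  \<open>q\<^sub>1 = - q\<^sub>2\<close> decouple from everything else and obey \<open>y(t + 1) = (\<delta> / 2) y(t - \<tau>\<^sub>2)\<close>, which
  yields the positive eigenvalue \<open>r\<close> with \<open>r ^ (\<tau>\<^sub>2 + 1) = \<delta> / 2 < 1\<close>. For \<open>n = 1\<close> nothing depends
  on the oldest value of \<open>q\<^sub>1\<close> (to first order), so \<open>0\<close> is an eigenvalue.
\<close>

section \<open>Coordinates of histories and of the delay map\<close>

lemma history_index_less:
  fixes d k i \<tau> :: nat
  assumes "i < d" "k \<le> \<tau>"
  shows "k * d + i < d * (\<tau> + 1)"
proof -
  have "k * d + i < (k + 1) * d" using assms(1) by simp
  also have "\<dots> \<le> (\<tau> + 1) * d" using assms(2) by (intro mult_right_mono) auto
  finally show ?thesis by (simp add: mult.commute)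
qed

lemma const_history_nth:
  assumes "i < d" "k \<le> \<tau>"
  shows "const_history d \<tau> E $ (k * d + i) = E $ i"
  using history_index_less[OF assms] assms(1) unfolding const_history_def by (subst index_vec) simp_all

lemma delay_map_nth_less:
  assumes "m < d"
  shows "delay_map d \<tau> G x $ m = G (\<lambda>i k. x $ (k * d + i)) m"
  using assms history_index_less[of m d 0 \<tau>] unfolding delay_map_def by (subst index_vec) simp_all

lemma delay_map_nth_ge:
  assumes "d \<le> m" "m < d * (\<tau> + 1)"
  shows "delay_map d \<tau> G x $ m = x $ (m - d)"
  using assms unfolding delay_map_def by (subst index_vec) simp_all

text \<open>\<open>is_jacobian\<close> differentiates along coordinate lines, on which every
  coordinate has constant derivative 0 or 1.\<close>

lemma has_real_derivative_vec_update:
  fixes x :: "real vec"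
  assumes "p < N"
  shows "((\<lambda>s. vec N (\<lambda>l. if l = j then s else x $ l) $ p) has_real_derivative unit_vec N j $ p)
    (at (x $ j))"
  using assms by (cases "p = j") (auto simp: unit_vec_def intro!: derivative_eq_intros)

lemma sum_unit_vec_mult:
  fixes x :: "'a :: semiring_1 vec"
  assumes "p < N"
  shows "(\<Sum>j<N. unit_vec N j $ p * x $ j) = x $ p"
proof -
  have "(\<Sum>j<N. unit_vec N j $ p * x $ j) = (\<Sum>j<N. if p = j then x $ j else 0)"
    using assms by (intro sum.cong) auto
  then show ?thesis using assms by simp
qed

section \<open>Eigenvalues of matrices\<close>

lemma eigenvalue_transpose_mat:
  fixes A :: "'a :: field mat"
  assumes "A \<in> carrier_mat n n"
  shows "eigenvalue (transpose_mat A) k \<longleftrightarrow> eigenvalue A k"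
  using assms eigenvalue_root_char_poly[of A n] eigenvalue_root_char_poly[of "transpose_mat A" n]
  by simp

text \<open>Both eigenvalues found below are real, whereas \<open>saddle_point\<close> refers to the
  complexified Jacobian matrix.\<close>

lemma eigenvalue_of_real:
  fixes A :: "real mat"
  assumes "A \<in> carrier_mat n n" "eigenvalue A r"
  shows "eigenvalue (map_mat complex_of_real A) (complex_of_real r)"
  by (rule of_real_hom.eigenvalue_hom[OF assms])

text \<open>Row \<open>p\<close> is \<open>c\<close> times a unit vector, so that unit vector is an
  eigenvector of the transpose, which has the same eigenvalues.\<close>

lemma eigenvalue_of_unit_row:
  fixes A :: "'a :: field mat"
  assumes A: "A \<in> carrier_mat N N" and "p < N"
    and row: "\<And>j. j < N \<Longrightarrow> A $$ (p, j) = (if j = p then c else 0)"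
  shows "eigenvalue A c"
proof -
  have "transpose_mat A *\<^sub>v unit_vec N p = c \<cdot>\<^sub>v unit_vec N p"
    using assms by (intro eq_vecI) auto
  moreover have "unit_vec N p \<noteq> (0\<^sub>v N :: 'a vec)"
    using \<open>p < N\<close> by (metis index_unit_vec(2) index_zero_vec(1) zero_neq_one)
  ultimately have "eigenvalue (transpose_mat A) c"
    using A unfolding eigenvalue_def eigenvector_def by (intro exI[of _ "unit_vec N p"]) simp
  then show ?thesis using eigenvalue_transpose_mat[OF A] by simp
qed

text \<open>The linearization at the boundary equilibrium; \<open>c\<close> stands for \<open>1 + \<alpha> (a\<^sub>0 - b \<delta> n q\<^sup>\<star>)\<close>.\<close>

definition oligopoly_lin ::
  "nat \<Rightarrow> real \<Rightarrow> real \<Rightarrow> nat \<Rightarrow> nat \<Rightarrow> (nat \<Rightarrow> nat \<Rightarrow> real) \<Rightarrow> nat \<Rightarrow> real" where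
  "oligopoly_lin n c \<delta> \<tau>0 \<tau>2 h j =
     (if j = 0 then c * h 0 0 else - \<delta> / 2 * h 0 \<tau>0 - \<delta> / 2 * (\<Sum>i\<in>{1..n} - {j}. h i \<tau>2))"

text \<open>The columns are the images of the unit vectors, so this matrix represents
  \<open>delay_map d \<tau> L\<close> when \<open>L\<close> is linear in the history.\<close>

definition delay_mat ::
  "nat \<Rightarrow> nat \<Rightarrow> ((nat \<Rightarrow> nat \<Rightarrow> real) \<Rightarrow> nat \<Rightarrow> real) \<Rightarrow> real mat" where
  "delay_mat d \<tau> L = mat (d * (\<tau> + 1)) (d * (\<tau> + 1))
     (\<lambda>(m, j). delay_map d \<tau> L (unit_vec (d * (\<tau> + 1)) j) $ m)"

lemma delay_mat_carrier: "delay_mat d \<tau> L \<in> carrier_mat (d * (\<tau> + 1)) (d * (\<tau> + 1))"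
  unfolding delay_mat_def by (rule mat_carrier)

lemma delay_mat_nth:
  assumes "m < d * (\<tau> + 1)" "j < d * (\<tau> + 1)"
  shows "delay_mat d \<tau> L $$ (m, j) = delay_map d \<tau> L (unit_vec (d * (\<tau> + 1)) j) $ m"
  using assms unfolding delay_mat_def by (subst index_mat) simp_all

text \<open>Linearity of \<open>oligopoly_lin\<close> and expansion of \<open>x\<close> in unit
  vectors. Eigenvectors can then be checked through the recursion instead of through matrix
  entries.\<close>

lemma delay_mat_oligopoly_lin_mult:
  fixes x :: "real vec"
  assumes \<tau>: "\<tau>0 \<le> \<tau>" "\<tau>2 \<le> \<tau>"
    and x: "x \<in> carrier_vec ((n + 1) * (\<tau> + 1))"
  shows "delay_mat (n + 1) \<tau> (oligopoly_lin n c \<delta> \<tau>0 \<tau>2) *\<^sub>v x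
    = delay_map (n + 1) \<tau> (oligopoly_lin n c \<delta> \<tau>0 \<tau>2) x"
    (is "delay_mat ?d \<tau> ?L *\<^sub>v x = _")
proof (rule eq_vecI)
  show "dim_vec (delay_mat ?d \<tau> ?L *\<^sub>v x) = dim_vec (delay_map ?d \<tau> ?L x)"
    by (simp add: delay_map_def delay_mat_def)
next
  fix m assume "m < dim_vec (delay_map ?d \<tau> ?L x)"
  then have m: "m < ?d * (\<tau> + 1)" by (simp add: delay_map_def)
  define N where "N = ?d * (\<tau> + 1)"
  note less = history_index_less[where d = ?d and \<tau> = \<tau>, folded N_def]
  have xN: "dim_vec x = N" using x by (simp add: N_def)
  have "(delay_mat ?d \<tau> ?L *\<^sub>v x) $ m = (\<Sum>j<N. delay_map ?d \<tau> ?L (unit_vec N j) $ m * x $ j)"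
    using m xN delay_mat_carrier[of ?d \<tau> ?L]
    by (simp add: scalar_prod_def atLeast0LessThan delay_mat_nth N_def)
  also have "\<dots> = delay_map ?d \<tau> ?L x $ m"
  proof (cases "m < ?d")
    case ge: False
    then show ?thesis using m sum_unit_vec_mult[of "m - ?d" N x]
      by (simp add: delay_map_nth_ge N_def)
  next
    case lt: True
    show ?thesis
    proof (cases "m = 0")
      case True
      then show ?thesis using sum_unit_vec_mult[OF less[of 0 0], of x]
        by (simp add: delay_map_nth_less oligopoly_lin_def mult.assoc flip: sum_distrib_left)
    next
      case False
      \<comment> \<open>Interchanging the sums reduces the claim to one unit vector expansion for
        each delayed coordinate.\<close>
      have "(\<Sum>j<N. (\<Sum>i\<in>{1..n} - {m}. unit_vec N j $ (\<tau>2 * ?d + i)) * x $ j)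
        = (\<Sum>i\<in>{1..n} - {m}. \<Sum>j<N. unit_vec N j $ (\<tau>2 * ?d + i) * x $ j)"
        unfolding sum_distrib_right by (rule sum.swap)
      also have "\<dots> = (\<Sum>i\<in>{1..n} - {m}. x $ (\<tau>2 * ?d + i))"
        by (rule sum.cong[OF refl], rule sum_unit_vec_mult, rule less) (use \<tau> in auto)
      finally have *: "(\<Sum>j<N. (\<Sum>i\<in>{1..n} - {m}. unit_vec N j $ (\<tau>2 * ?d + i)) * x $ j)
        = (\<Sum>i\<in>{1..n} - {m}. x $ (\<tau>2 * ?d + i))" .
      have "(\<Sum>j<N. delay_map ?d \<tau> ?L (unit_vec N j) $ m * x $ j)
        = - \<delta> / 2 * (\<Sum>j<N. unit_vec N j $ (\<tau>0 * ?d + 0) * x $ j)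
          - \<delta> / 2 * (\<Sum>j<N. (\<Sum>i\<in>{1..n} - {m}. unit_vec N j $ (\<tau>2 * ?d + i)) * x $ j)"
        using False unfolding delay_map_nth_less[OF lt] oligopoly_lin_def
        by (simp only: if_False left_diff_distrib mult.assoc sum_subtractf sum_distrib_left[symmetric])
      also have "\<dots> = delay_map ?d \<tau> ?L x $ m"
        unfolding delay_map_nth_less[OF lt] oligopoly_lin_def *
        using False sum_unit_vec_mult[OF less[of 0 \<tau>0], of x] \<tau> by simp
      finally show ?thesis .
    qed
  qed
  finally show "(delay_mat ?d \<tau> ?L *\<^sub>v x) $ m = delay_map ?d \<tau> ?L x $ m" .
qed

section \<open>The Jacobian matrix and the equilibrium\<close>

text \<open>Shift rows copy a coordinate, and rows \<open>1\<close> to \<open>n\<close> are affine.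
  In row 0 the product rule multiplies the derivative of the bracket by \<open>q0 = 0\<close>, so
  the lag \<open>\<tau>1\<close> enters only through the total \<open>Q\<close>.\<close>

lemma is_jacobian_oligopoly:
  fixes \<alpha> b \<delta> a0 a1 Q :: real
  assumes \<tau>: "\<tau>0 \<le> \<tau>" "\<tau>1 \<le> \<tau>" "\<tau>2 \<le> \<tau>"
    and E0: "E $ 0 = 0" and E: "(\<Sum>i\<in>{1..n}. E $ i) = Q"
  shows "is_jacobian ((n + 1) * (\<tau> + 1))
    (delay_map (n + 1) \<tau> (oligopoly_rhs n \<alpha> b \<delta> a0 a1 \<tau>0 \<tau>1 \<tau>2)) (const_history (n + 1) \<tau> E)
    (delay_mat (n + 1) \<tau> (oligopoly_lin n (1 + \<alpha> * (a0 - b * \<delta> * Q)) \<delta> \<tau>0 \<tau>2))"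
    (is "is_jacobian ?N (delay_map ?d \<tau> ?G) ?x (delay_mat ?d \<tau> ?L)")
  unfolding is_jacobian_def
proof (intro conjI allI impI)
  show "delay_mat ?d \<tau> ?L \<in> carrier_mat ?N ?N" by (rule delay_mat_carrier)
next
  fix m j assume m: "m < ?N" and j: "j < ?N"
  define N where "N = ?N"
  define y where "y = (\<lambda>s. vec N (\<lambda>l. if l = j then s else ?x $ l))"
  note less = history_index_less[where d = ?d and \<tau> = \<tau>, folded N_def]
  have D: "((\<lambda>s. y s $ p) has_real_derivative unit_vec N j $ p) (at (?x $ j))" if "p < N" for p
    unfolding y_def using that by (rule has_real_derivative_vec_update)
  have D_hist: "((\<lambda>s. y s $ (k * ?d + i)) has_real_derivative unit_vec N j $ (k * ?d + i))
    (at (?x $ j))" if "i \<le> n" "k \<le> \<tau>" for i k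
    using that by (intro D less) auto
  \<comment> \<open>At the base point, coordinate \<open>j\<close> is replaced by its own value, so
    the history is unchanged.\<close>
  have y_hist: "y (?x $ j) $ (k * ?d + i) = E $ i" if "i \<le> n" "k \<le> \<tau>" for i k
  proof -
    have "k * ?d + i < N" using that by (intro less) auto
    then have "y (?x $ j) $ (k * ?d + i) = ?x $ (k * ?d + i)" by (auto simp: y_def)
    then show ?thesis using that const_history_nth[of i ?d k \<tau> E] by simp
  qed
  have "((\<lambda>s. delay_map ?d \<tau> ?G (y s) $ m) has_real_derivative
    delay_map ?d \<tau> ?L (unit_vec N j) $ m) (at (?x $ j))"
  proof (cases "m < ?d")
    case False
    then show ?thesis using m D[of "m - ?d"] by (simp add: delay_map_nth_ge N_def)
  next
    case lt: True
    show ?thesis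
    proof (cases "m = 0")
      case True
      have Q: "(\<Sum>i\<in>{1..n}. y (?x $ j) $ (\<tau>1 * ?d + i)) = Q"
        unfolding E[symmetric] using \<tau> by (intro sum.cong y_hist) auto
      have S: "((\<lambda>s. \<Sum>i\<in>{1..n}. y s $ (\<tau>1 * ?d + i)) has_real_derivative
        (\<Sum>i\<in>{1..n}. unit_vec N j $ (\<tau>1 * ?d + i))) (at (?x $ j))"
        by (rule DERIV_sum, rule D_hist) (use \<tau> in auto)
      \<comment> \<open>The index stays in the form \<open>0 * ?d + 0\<close> to match the terms
        that the product rule produces.\<close>
      have y0: "y (?x $ j) $ (0 * ?d + 0) = 0" using y_hist[of 0 0] E0 by simp
      have "((\<lambda>s. y s $ (0 * ?d + 0) + \<alpha> * y s $ (0 * ?d + 0) * (a0 - b * y s $ (0 * ?d + 0)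
          - b * \<delta> * (\<Sum>i\<in>{1..n}. y s $ (\<tau>1 * ?d + i)))) has_real_derivative
        (1 + \<alpha> * (a0 - b * \<delta> * Q)) * unit_vec N j $ (0 * ?d + 0)) (at (?x $ j))"
        by (rule derivative_eq_intros refl S D_hist[of 0 0, OF le0 le0])+
          (simp only: y0 Q, simp add: algebra_simps)
      then show ?thesis
        unfolding delay_map_nth_less[OF lt] oligopoly_rhs_def oligopoly_lin_def using True by simp
    next
      case False
      have S: "((\<lambda>s. \<Sum>i\<in>{1..n} - {m}. y s $ (\<tau>2 * ?d + i)) has_real_derivative
        (\<Sum>i\<in>{1..n} - {m}. unit_vec N j $ (\<tau>2 * ?d + i))) (at (?x $ j))"
        by (rule DERIV_sum, rule D_hist) (use \<tau> in auto)
      have "((\<lambda>s. a1 / (2 * b) - \<delta> / 2 * y s $ (\<tau>0 * ?d + 0)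
          - \<delta> / 2 * (\<Sum>i\<in>{1..n} - {m}. y s $ (\<tau>2 * ?d + i))) has_real_derivative
        - \<delta> / 2 * unit_vec N j $ (\<tau>0 * ?d + 0)
          - \<delta> / 2 * (\<Sum>i\<in>{1..n} - {m}. unit_vec N j $ (\<tau>2 * ?d + i))) (at (?x $ j))"
        using DERIV_diff[OF DERIV_diff[OF DERIV_const DERIV_cmult[OF D_hist[of 0 \<tau>0, OF le0 \<tau>(1)]]]
            DERIV_cmult[OF S]]
        by (rule DERIV_cong) simp
      then show ?thesis
        unfolding delay_map_nth_less[OF lt] oligopoly_rhs_def oligopoly_lin_def using False by simp
    qed
  qed
  then show "((\<lambda>s. delay_map ?d \<tau> ?G (vec ?N (\<lambda>l. if l = j then s else ?x $ l)) $ m)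
    has_real_derivative delay_mat ?d \<tau> ?L $$ (m, j)) (at (?x $ j))"
    unfolding delay_mat_nth[OF m j] y_def N_def .
qed

text \<open>Row 0 is preserved because of its factor \<open>q0 = 0\<close>. With
  \<open>q1 = ... = qn = q\<close>, the other rows require
  \<open>2 * q + (n - 1) * \<delta> * q = a1 / b\<close>, which determines \<open>q\<close>.\<close>

lemma is_equilibrium_boundary:
  fixes \<alpha> b \<delta> a0 a1 :: real
  assumes \<tau>: "\<tau>0 \<le> \<tau>" "\<tau>1 \<le> \<tau>" "\<tau>2 \<le> \<tau>"
    and b: "b \<noteq> 0" and nz: "2 + (real n - 1) * \<delta> \<noteq> 0"
  shows "is_equilibrium (n + 1) \<tau> (oligopoly_rhs n \<alpha> b \<delta> a0 a1 \<tau>0 \<tau>1 \<tau>2)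
    (boundary_equilibrium n b \<delta> a1)"
    (is "is_equilibrium ?d \<tau> ?G ?E")
  unfolding is_equilibrium_def
proof (intro conjI eq_vecI)
  show "?E \<in> carrier_vec ?d" by (simp add: boundary_equilibrium_def)
  show "dim_vec (delay_map ?d \<tau> ?G (const_history ?d \<tau> ?E)) = dim_vec (const_history ?d \<tau> ?E)"
    by (simp add: delay_map_def const_history_def)
next
  let ?x = "const_history ?d \<tau> ?E"
  define q where "q = a1 / (b * (2 + (real n - 1) * \<delta>))"
  fix m assume "m < dim_vec ?x"
  then have m: "m < ?d * (\<tau> + 1)" by (simp add: const_history_def)
  have h: "?x $ (k * ?d + i) = (if i = 0 then 0 else q)" if "i \<le> n" "k \<le> \<tau>" for i k
    using const_history_nth[of i ?d k \<tau> ?E] that by (simp add: boundary_equilibrium_def q_def)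
  show "delay_map ?d \<tau> ?G ?x $ m = ?x $ m"
  proof (cases "m < ?d")
    case False
    then show ?thesis using m
      by (simp add: delay_map_nth_ge const_history_def le_mod_geq)
  next
    case lt: True
    show ?thesis
    proof (cases "m = 0")
      case True
      then show ?thesis using h[of 0 0] by (simp add: delay_map_nth_less oligopoly_rhs_def)
    next
      case False
      have "(\<Sum>i\<in>{1..n} - {m}. ?x $ (\<tau>2 * ?d + i)) = (\<Sum>i\<in>{1..n} - {m}. q)"
        by (rule sum.cong[OF refl], subst h) (use \<tau> in auto)
      also have "\<dots> = (real n - 1) * q"
        using False lt by (simp add: of_nat_diff)
      finally have s: "(\<Sum>i\<in>{1..n} - {m}. ?x $ (\<tau>2 * ?d + i)) = (real n - 1) * q" .
      have "delay_map ?d \<tau> ?G ?x $ m = a1 / (2 * b) - \<delta> / 2 * ((real n - 1) * q)"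
        unfolding delay_map_nth_less[OF lt] oligopoly_rhs_def s using False h[of 0 \<tau>0] \<tau> by simp
      \<comment> \<open>This equation is not a link of the chain; it only serves to derive the next
        one.\<close>
      also have "a1 / b = q * (2 + (real n - 1) * \<delta>)"
        using b nz by (simp add: q_def)
      then have "a1 / (2 * b) - \<delta> / 2 * ((real n - 1) * q) = q"
        by (simp add: field_simps)
      also have "q = ?x $ m" using h[of m 0] lt False by simp
      finally show ?thesis .
    qed
  qed
qed

section \<open>Eigenvalues of the linearization\<close>

text \<open>Substituting \<open>y(t) = r ^ t * v\<close> with \<open>v 0 = 0\<close> leaves
  \<open>ev\<close> as the characteristic equation, and the history of this solution is the
  eigenvector.\<close>

lemma eigenvalue_delay_mat_oligopoly_lin:
  fixes r \<delta> :: real and v :: "nat \<Rightarrow> real"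
  assumes \<tau>: "\<tau>0 \<le> \<tau>" "\<tau>2 \<le> \<tau>"
    and v0: "v 0 = 0" and p: "p \<le> n" "v p \<noteq> 0"
    and ev: "\<And>j. \<lbrakk>1 \<le> j; j \<le> n\<rbrakk> \<Longrightarrow> - \<delta> / 2 * (\<Sum>i\<in>{1..n} - {j}. v i) = r ^ (\<tau>2 + 1) * v j"
  shows "eigenvalue (delay_mat (n + 1) \<tau> (oligopoly_lin n c \<delta> \<tau>0 \<tau>2)) r"
    (is "eigenvalue (delay_mat ?d \<tau> ?L) r")
proof -
  define N where "N = ?d * (\<tau> + 1)"
  \<comment> \<open>This is the history of \<open>r ^ t * v\<close> at time
    \<open>t = \<tau>\<close>. All exponents are nonnegative, so \<open>r = 0\<close> is covered as
    well.\<close>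
  define x where "x = vec N (\<lambda>m. r ^ (\<tau> - m div ?d) * v (m mod ?d))"
  note less = history_index_less[where d = ?d and \<tau> = \<tau>, folded N_def]
  have x: "x $ (k * ?d + i) = r ^ (\<tau> - k) * v i" if "i \<le> n" "k \<le> \<tau>" for i k
  proof -
    have "(k * d + i) div d = k" "(k * d + i) mod d = i" if "i < d" for d using that by simp_all
    from this[of ?d] show ?thesis
      using less[of i k] that unfolding x_def by (subst index_vec) (simp_all only: less_Suc_eq_le flip: Suc_eq_plus1)
  qed
  have "delay_map ?d \<tau> ?L x = r \<cdot>\<^sub>v x"
  proof (rule eq_vecI)
    show "dim_vec (delay_map ?d \<tau> ?L x) = dim_vec (r \<cdot>\<^sub>v x)"
      by (simp add: delay_map_def x_def N_def)
  next
    fix m assume "m < dim_vec (r \<cdot>\<^sub>v x)"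
    then have m: "m < N" by (simp add: x_def)
    then have rx: "(r \<cdot>\<^sub>v x) $ m = r * (r ^ (\<tau> - m div ?d) * v (m mod ?d))" by (simp add: x_def)
    show "delay_map ?d \<tau> ?L x $ m = (r \<cdot>\<^sub>v x) $ m"
    proof (cases "m < ?d")
      case False
      then have div: "m div ?d = Suc ((m - ?d) div ?d)" and mod: "m mod ?d = (m - ?d) mod ?d"
        by (simp_all add: le_div_geq le_mod_geq)
      \<comment> \<open>The bound prevents truncation in \<open>\<tau> - m div ?d\<close>, so moving
        to the next newer block raises the exponent by exactly one.\<close>
      have "m div ?d < \<tau> + 1"
        using m unfolding N_def by (simp add: less_mult_imp_div_less mult.commute)
      then have "\<tau> - (m - ?d) div ?d = Suc (\<tau> - m div ?d)" using div by simp
      then have "x $ (m - ?d) = r ^ Suc (\<tau> - m div ?d) * v (m mod ?d)"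
        using m unfolding x_def mod by (subst index_vec) (simp, simp only:)
      moreover have "delay_map ?d \<tau> ?L x $ m = x $ (m - ?d)"
        using False m unfolding N_def by (intro delay_map_nth_ge) simp_all
      ultimately show ?thesis unfolding rx by simp
    next
      case lt: True
      show ?thesis
      proof (cases "m = 0")
        case True
        then show ?thesis unfolding rx using x[of 0 0] v0
          by (simp add: delay_map_nth_less oligopoly_lin_def)
      next
        case False
        have "(\<Sum>i\<in>{1..n} - {m}. x $ (\<tau>2 * ?d + i)) = r ^ (\<tau> - \<tau>2) * (\<Sum>i\<in>{1..n} - {m}. v i)"
          unfolding sum_distrib_left by (rule sum.cong[OF refl], rule x) (use \<tau> in auto)
        then have "delay_map ?d \<tau> ?L x $ m
          = r ^ (\<tau> - \<tau>2) * (- \<delta> / 2 * (\<Sum>i\<in>{1..n} - {m}. v i))"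
          unfolding delay_map_nth_less[OF lt] oligopoly_lin_def using False x[of 0 \<tau>0] v0 \<tau> by simp
        also have "\<dots> = r ^ (\<tau> - \<tau>2) * (r ^ (\<tau>2 + 1) * v m)"
          using ev[of m] False lt by simp
        also have "\<dots> = r ^ (\<tau> - \<tau>2 + (\<tau>2 + 1)) * v m"
          by (simp only: power_add mult.assoc)
        \<comment> \<open>Since \<open>\<tau>2 \<le> \<tau>\<close>, the powers combine to
          \<open>r\<close> times the weight \<open>r ^ \<tau>\<close> of the newest block.\<close>
        also have "\<tau> - \<tau>2 + (\<tau>2 + 1) = Suc \<tau>" using \<tau> by simp
        also have "r ^ Suc \<tau> * v m = (r \<cdot>\<^sub>v x) $ m" unfolding rx using lt by simp
        finally show ?thesis .
      qed
    qed
  qed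
  moreover have "x \<in> carrier_vec N" by (simp add: x_def)
  \<comment> \<open>The oldest block has weight \<open>r ^ 0 = 1\<close>, so it equals
    \<open>v\<close> even for \<open>r = 0\<close>.\<close>
  moreover have "x \<noteq> 0\<^sub>v N"
    using x[of p \<tau>] p less[of p \<tau>] by (metis Suc_eq_plus1 cancel_comm_monoid_add_class.diff_cancel
        index_zero_vec(1) le_imp_less_Suc le_refl mult_1 power_0)
  ultimately show ?thesis
    using delay_mat_oligopoly_lin_mult[OF \<tau>, of x n c \<delta>] delay_mat_carrier[of ?d \<tau> ?L]
    unfolding eigenvalue_def eigenvector_def N_def by auto
qed

lemma eigenvalue_inside_unit_disc:
  fixes \<delta> :: real
  assumes \<tau>: "\<tau>0 \<le> \<tau>" "\<tau>2 \<le> \<tau>" and "n \<ge> 1" and \<delta>: "0 \<le> \<delta>" "\<delta> < 2"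
  shows "\<exists>r. \<bar>r\<bar> < 1 \<and> eigenvalue (delay_mat (n + 1) \<tau> (oligopoly_lin n c \<delta> \<tau>0 \<tau>2)) r"
proof (cases "n = 1")
  case True
  have "eigenvalue (delay_mat (n + 1) \<tau> (oligopoly_lin n c \<delta> \<tau>0 \<tau>2)) 0"
    \<comment> \<open>For \<open>n = 1\<close> the sum in \<open>ev\<close> is empty, and the
      right-hand side is \<open>0 ^ (\<tau>2 + 1) = 0\<close>.\<close>
    by (rule eigenvalue_delay_mat_oligopoly_lin[OF \<tau>, where v = "\<lambda>i. if i = 1 then 1 else 0" and p = 1])
      (use True in auto)
  then show ?thesis by (intro exI[of _ 0]) simp
next
  case False
  then have n: "2 \<le> n" using assms by simp
  define r where "r = root (\<tau>2 + 1) (\<delta> / 2)"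
  have r: "r ^ Suc \<tau>2 = \<delta> / 2" unfolding r_def using \<delta> by (simp del: power_Suc)
  have "0 \<le> r" "r < 1" unfolding r_def using \<delta> by simp_all
  define v :: "nat \<Rightarrow> real" where "v = (\<lambda>i. if i = 1 then 1 else if i = 2 then - 1 else 0)"
  have "(\<Sum>i\<in>{1..n}. v i) = (\<Sum>i\<in>{1, 2}. v i)"
    using n by (intro sum.mono_neutral_right) (auto simp: v_def)
  then have "(\<Sum>i\<in>{1..n}. v i) = 0" by (simp add: v_def)
  \<comment> \<open>As \<open>v\<close> sums to zero, omitting index \<open>j\<close> leaves
    \<open>- v j\<close>, and every equation in \<open>ev\<close> becomes
    \<open>\<delta> / 2 * v j = r ^ (\<tau>2 + 1) * v j\<close>.\<close>
  then have "(\<Sum>i\<in>{1..n} - {j}. v i) = - v j" if "1 \<le> j" "j \<le> n" for j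
    using that by (simp add: sum_diff1)
  then have "eigenvalue (delay_mat (n + 1) \<tau> (oligopoly_lin n c \<delta> \<tau>0 \<tau>2)) r"
    using n by (intro eigenvalue_delay_mat_oligopoly_lin[OF \<tau>, where v = v and p = 1])
      (auto simp: r v_def simp del: power_Suc)
  then show ?thesis using \<open>0 \<le> r\<close> \<open>r < 1\<close> by (intro exI[of _ r]) simp
qed

lemma eigenvalue_oligopoly_lin_leading:
  "eigenvalue (delay_mat (n + 1) \<tau> (oligopoly_lin n c \<delta> \<tau>0 \<tau>2)) c"
proof (rule eigenvalue_of_unit_row[OF delay_mat_carrier])
  show "0 < (n + 1) * (\<tau> + 1)" by simp
  fix j assume j: "j < (n + 1) * (\<tau> + 1)"
  then show "delay_mat (n + 1) \<tau> (oligopoly_lin n c \<delta> \<tau>0 \<tau>2) $$ (0, j) = (if j = 0 then c else 0)"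
    unfolding delay_mat_nth[OF \<open>0 < (n + 1) * (\<tau> + 1)\<close> j]
    by (simp add: delay_map_nth_less oligopoly_lin_def)
qed

theorem theorem1:
  fixes n \<tau>0 \<tau>1 \<tau>2 :: nat
    and \<alpha> b \<delta> a0 a1 :: real
  assumes "n \<ge> 1"
    and "\<alpha> > 0" and "b > 0"
    and "0 < \<delta>" and "\<delta> < 1"
    and "0 < a0" and "a0 \<le> a1"
    and "(2 + (real n - 1) * \<delta>) * a0 > real n * \<delta> * a1"
  shows "saddle_point (n + 1) (max \<tau>0 (max \<tau>1 \<tau>2))
           (oligopoly_rhs n \<alpha> b \<delta> a0 a1 \<tau>0 \<tau>1 \<tau>2)
           (boundary_equilibrium n b \<delta> a1)"
proof -
  let ?\<tau> = "max \<tau>0 (max \<tau>1 \<tau>2)" and ?E = "boundary_equilibrium n b \<delta> a1"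
  have \<tau>: "\<tau>0 \<le> ?\<tau>" "\<tau>1 \<le> ?\<tau>" "\<tau>2 \<le> ?\<tau>" by auto
  define w where "w = 2 + (real n - 1) * \<delta>"
  have w: "w > 0" unfolding w_def using assms by (intro add_pos_nonneg mult_nonneg_nonneg) auto
  \<comment> \<open>\<open>Q\<close> is the sum of the coordinates \<open>1\<close> to
    \<open>n\<close> of the equilibrium.\<close>
  define Q where "Q = real n * (a1 / (b * w))"
  define c where "c = 1 + \<alpha> * (a0 - b * \<delta> * Q)"
  let ?J = "delay_mat (n + 1) ?\<tau> (oligopoly_lin n c \<delta> \<tau>0 \<tau>2)"
  have "(\<Sum>i\<in>{1..n}. ?E $ i) = (\<Sum>i\<in>{1..n}. a1 / (b * w))"
    unfolding boundary_equilibrium_def w_def by (intro sum.cong) auto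
  then have "(\<Sum>i\<in>{1..n}. ?E $ i) = Q" by (simp add: Q_def)
  moreover have "?E $ 0 = 0" by (simp add: boundary_equilibrium_def)
  ultimately have jac: "is_jacobian ((n + 1) * (?\<tau> + 1))
    (delay_map (n + 1) ?\<tau> (oligopoly_rhs n \<alpha> b \<delta> a0 a1 \<tau>0 \<tau>1 \<tau>2)) (const_history (n + 1) ?\<tau> ?E) ?J"
    unfolding c_def by (intro is_jacobian_oligopoly \<tau>)
  \<comment> \<open>After \<open>b\<close> cancels, dividing the assumed inequality by
    \<open>w > 0\<close> gives \<open>b * \<delta> * Q < a0\<close>, that is,
    \<open>c > 1\<close>.\<close>
  have "b * \<delta> * Q = real n * \<delta> * a1 / w" using assms by (simp add: Q_def)
  also have "\<dots> < a0" using assms(8) w by (simp add: w_def pos_divide_less_eq mult.commute)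
  finally have "c > 1" using \<open>\<alpha> > 0\<close> by (simp add: c_def)
  then have large: "\<exists>z. eigenvalue (map_mat complex_of_real ?J) z \<and> cmod z > 1"
    using eigenvalue_of_real[OF delay_mat_carrier eigenvalue_oligopoly_lin_leading]
    by (intro exI[of _ "complex_of_real c"]) simp
  obtain r where "\<bar>r\<bar> < 1" "eigenvalue ?J r"
    using eigenvalue_inside_unit_disc[OF \<tau>(1,3), of n \<delta> c] assms by auto
  then have small: "\<exists>z. eigenvalue (map_mat complex_of_real ?J) z \<and> cmod z < 1"
    using eigenvalue_of_real[OF delay_mat_carrier]
    by (intro exI[of _ "complex_of_real r"]) simp
  have "is_equilibrium (n + 1) ?\<tau> (oligopoly_rhs n \<alpha> b \<delta> a0 a1 \<tau>0 \<tau>1 \<tau>2) ?E"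
    using \<tau> assms(3) w by (intro is_equilibrium_boundary) (auto simp: w_def)
  with jac large small show ?thesis unfolding saddle_point_def by blast
qed

end
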